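(* Let $r\ge 2$ and let $H$ be a connected $r$-uniform linear hypergraph on $n$ vertices, with at least one edge, with spectral radius $\rho$ and principal eigenvector $x$. For any $v\in V(H)$, if $d$ is the degree of $v$, then $$x_v\le \frac{1}{\left(1+(r-1)\left(\frac{\rho^r}{d}\right)^{\frac{1}{r-1}}\right)^{1/r}}.$$
   Context: A hypergraph $H=(V(H),E(H))$ on $n$ vertices has vertex set $V(H)=[n]=\{1,\dots,n\}$ (after labelling) and a set $E(H)$ of edges, which are subsets of $V(H)$; it is $r$-uniform if every edge contains exactly $r$ vertices. It is linear if any two distinct edges have at most one common vertex. The degree of a vertex is the number of edges containing it. A path is an alternating sequence $v_1e_1v_2e_2\cdots v_\ell e_\ell v_{\ell+1}$ with $v_i,v_{i+1}\in e_i$ for $1\le i\le \ell$, all vertices and all edges in it being distinct; $H$ is connected if any two vertices are joined by a path. The adjacency tensor $\mathcal{A}(H)$ is the order $r$, dimension $n$ tensor whose $(i_1i_2\cdots i_r)$-entry is $\frac{1}{(r-1)!}$ if $\{i_1,\dots,i_r\}\in E(H)$ and $0$ otherwise. For an order $r$ dimension $n$ tensor $\mathcal{A}=(a_{i_1\cdots i_r})$ and $x\in\mathbb{C}^n$, $\mathcal{A}x$ is the vector in $\mathbb{C}^n$ with $(\mathcal{A}x)_i=\sum_{i_2,\dots,i_r=1}^n a_{ii_2\cdots i_r}x_{i_2}\cdots x_{i_r}$. A number $\lambda\in\mathbb{C}$ is an eigenvalue of $\mathcal{A}$ with eigenvector $x\neq 0$ if $(\mathcal{A}x)_i=\lambda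 x_i^{r-1}$ for all $i$. The spectral radius $\rho(H)$ is the maximum modulus of the eigenvalues of $\mathcal{A}(H)$. For connected $H$, the principal eigenvector of $H$ is the unique eigenvector $x$ of $\mathcal{A}(H)$ corresponding to $\rho(H)$ with all entries positive and $\|x\|_r=\left(\sum_i x_i^r\right)^{1/r}=1$; $x_v$ denotes its entry at vertex $v$. *)

theory Defs
  imports "HOL-Analysis.Analysis"
begin

text \<open>
  The vertex set is the whole finite type \<open>'n\<close>, so \<open>n = CARD('n)\<close>, and a hypergraph is given by
  its edge set.
\<close>

type_synonym 'n hypergraph = "'n set set"

definition uniform :: "nat \<Rightarrow> 'n::finite hypergraph \<Rightarrow> bool" where
  "uniform r H \<longleftrightarrow> (\<forall>e\<in>H. card e = r)"

definition linear_hypergraph :: "'n::finite hypergraph \<Rightarrow> bool" where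
  "linear_hypergraph H \<longleftrightarrow> (\<forall>e\<in>H. \<forall>f\<in>H. e \<noteq> f \<longrightarrow> card (e \<inter> f) \<le> 1)"

definition vertex_degree :: "'n::finite hypergraph \<Rightarrow> 'n \<Rightarrow> nat" where
  "vertex_degree H v = card {e \<in> H. v \<in> e}"

text \<open>
  The alternating sequence \<open>v\<^sub>1 e\<^sub>1 \<dots> e\<^sub>l v\<^sub>l\<^sub>+\<^sub>1\<close> is split into its list of vertices and its list of
  edges. A single vertex counts as a path of length 0 from itself to itself.
\<close>

definition is_path :: "'n::finite hypergraph \<Rightarrow> 'n list \<Rightarrow> 'n set list \<Rightarrow> bool" where
  "is_path H vs es \<longleftrightarrow>
     length vs = length es + 1 \<and> distinct vs \<and> distinct es \<and> set es \<subseteq> H \<and>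
     (\<forall>i<length es. vs ! i \<in> es ! i \<and> vs ! (i + 1) \<in> es ! i)"

definition connected_hypergraph :: "'n::finite hypergraph \<Rightarrow> bool" where
  "connected_hypergraph H \<longleftrightarrow>
     (\<forall>u w. \<exists>vs es. is_path H vs es \<and> hd vs = u \<and> last vs = w)"

text \<open>
  A tensor of order \<open>r\<close> and dimension \<open>CARD('n)\<close> is a function on index lists; only its values on
  lists of length \<open>r\<close> are ever used.
\<close>

type_synonym 'n tensor = "'n list \<Rightarrow> complex"

definition tensor_apply :: "nat \<Rightarrow> 'n::finite tensor \<Rightarrow> complex ^ 'n \<Rightarrow> complex ^ 'n" where
  "tensor_apply r A x =
     (\<chi> i. \<Sum>js | length js = r - 1. A (i # js) * (\<Prod>j\<leftarrow>js. x $ j))"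

definition eigenpair :: "nat \<Rightarrow> 'n::finite tensor \<Rightarrow> complex \<Rightarrow> complex ^ 'n \<Rightarrow> bool" where
  "eigenpair r A l x \<longleftrightarrow> x \<noteq> 0 \<and> (\<forall>i. tensor_apply r A x $ i = l * (x $ i) ^ (r - 1))"

definition eigenvalue :: "nat \<Rightarrow> 'n::finite tensor \<Rightarrow> complex \<Rightarrow> bool" where
  "eigenvalue r A l \<longleftrightarrow> (\<exists>x. eigenpair r A l x)"

definition adjacency_tensor :: "nat \<Rightarrow> 'n::finite hypergraph \<Rightarrow> 'n tensor" where
  "adjacency_tensor r H is = (if set is \<in> H then 1 / fact (r - 1) else 0)"

definition spectral_radius :: "nat \<Rightarrow> 'n::finite hypergraph \<Rightarrow> real" where
  "spectral_radius r H =
     (GREATEST t. \<exists>l. eigenvalue r (adjacency_tensor r H) l \<and> t = cmod l)"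

text \<open>
  For connected \<open>H\<close> the vector with this property is unique (Perron--Frobenius); uniqueness is a
  consequence and not part of the definition.
\<close>

definition principal_eigenvector :: "nat \<Rightarrow> 'n::finite hypergraph \<Rightarrow> real ^ 'n \<Rightarrow> bool" where
  "principal_eigenvector r H x \<longleftrightarrow>
     eigenpair r (adjacency_tensor r H) (complex_of_real (spectral_radius r H))
       (\<chi> i. complex_of_real (x $ i)) \<and>
     (\<forall>i. x $ i > 0) \<and>
     (\<Sum>i\<in>UNIV. (x $ i) ^ r) powr (1 / real r) = 1"

end

theory Submission
  imports Defs "HOL-Combinatorics.Multiset_Permutations"
begin

text \<open>
  The bound compares \<open>x\<^sub>v\<close> with its neighbours. The eigenvalue equation at \<open>v\<close> says that
  \<open>\<rho> x\<^sub>v\<^bsup>r-1\<^esup>\<close> is the sum, over the edges \<open>e\<close> through \<open>v\<close>, of the products \<open>\<Prod>j\<in>e-{v}. x\<^sub>j\<close>. For each such edge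
  the inequality between the arithmetic and the geometric mean, applied to the \<open>r\<close> numbers
  \<open>s x\<^sub>v\<close> and \<open>x\<^sub>j\<close> for \<open>j \<in> e - {v}\<close>, bounds the product by a combination of \<open>r\<close>-th powers. By
  linearity the sets \<open>e - {v}\<close> are disjoint, so adding these bounds uses every \<open>x\<^sub>j\<^bsup>r\<^esup>\<close> at most once
  and yields
  \<open>x\<^sub>v\<^bsup>r\<^esup> (1 + r s \<rho> - d s\<^bsup>r\<^esup>) \<le> \<Sum>\<^sub>j x\<^sub>j\<^bsup>r\<^esup> = 1\<close>
  for every \<open>s \<ge> 0\<close> (lemma \<open>star_bound\<close>). For \<open>d > 0\<close> the bracket is maximal at \<open>s\<^bsup>r-1\<^esup> = \<rho> / d\<close>, where it equals
  \<open>1 + (r - 1) (\<rho>\<^bsup>r\<^esup> / d)\<^bsup>1/(r-1)\<^esup>\<close>, and taking \<open>r\<close>-th roots gives the claim.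
\<close>

text \<open>
  An edge of size \<open>r\<close> through \<open>i\<close> arises from exactly the \<open>(r - 1)!\<close> orderings of its other
  vertices, which cancels the normalising factor of the adjacency tensor.
\<close>

lemma tensor_apply_adjacency_tensor:
  fixes H :: "'n::finite hypergraph"
  assumes r: "r \<ge> 1" and unif: "uniform r H"
  shows "tensor_apply r (adjacency_tensor r H) y $ i
    = (\<Sum>e\<in>{e \<in> H. i \<in> e}. \<Prod>j\<in>e - {i}. y $ j)"
proof -
  let ?L = "{js :: 'n list. length js = r - 1}"
  let ?E = "{e \<in> H. i \<in> e}"
  have fin: "finite ?L"
    using finite_lists_length_eq[of "UNIV :: 'n set" "r - 1"] by simp
  have orderings: "{js \<in> ?L. insert i (set js) = e} = permutations_of_set (e - {i})"
    if e: "e \<in> ?E" for e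
  proof -
    have card: "card (e - {i}) = r - 1"
      using e unif by (simp add: uniform_def)
    have "js \<in> permutations_of_set (e - {i})" if "length js = r - 1" "insert i (set js) = e" for js
    proof -
      have "e - {i} \<subseteq> set js" using that by auto
      \<comment> \<open>Too few entries are available for \<open>i\<close> itself or a repetition to occur.\<close>
      moreover have "card (set js) \<le> card (e - {i})"
        using card that(1) card_length[of js] by simp
      ultimately have set: "set js = e - {i}"
        using card_seteq[of "set js" "e - {i}"] by simp
      then have "distinct js"
        using card that(1) by (intro card_distinct) simp
      with set show ?thesis
        by (rule permutations_of_setI)
    qed
    then show ?thesis
      using e card by (auto dest: permutations_of_setD length_finite_permutations_of_set)
  qed
  have "tensor_apply r (adjacency_tensor r H) y $ i
      = (\<Sum>js\<in>?L. if insert i (set js) \<in> ?E then (\<Prod>j\<leftarrow>js. y $ j) / fact (r - 1) else 0)"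
    by (auto simp: tensor_apply_def adjacency_tensor_def intro!: sum.cong)
  also have "\<dots> = (\<Sum>js\<in>{js \<in> ?L. insert i (set js) \<in> ?E}. (\<Prod>j\<leftarrow>js. y $ j) / fact (r - 1))"
    by (subst sum.inter_filter[OF fin]) simp
  also have "\<dots> = (\<Sum>e\<in>?E. \<Sum>js\<in>{js \<in> {js \<in> ?L. insert i (set js) \<in> ?E}. insert i (set js) = e}.
                     (\<Prod>j\<leftarrow>js. y $ j) / fact (r - 1))"
    using fin by (intro sum.group[symmetric]) auto
  also have "\<dots> = (\<Sum>e\<in>?E. \<Sum>js\<in>permutations_of_set (e - {i}). (\<Prod>j\<leftarrow>js. y $ j) / fact (r - 1))"
  proof (intro sum.cong refl)
    fix e assume e: "e \<in> ?E"
    then have "{js \<in> {js \<in> ?L. insert i (set js) \<in> ?E}. insert i (set js) = e}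
        = {js \<in> ?L. insert i (set js) = e}"
      by blast
    then show "{js \<in> {js \<in> ?L. insert i (set js) \<in> ?E}. insert i (set js) = e}
        = permutations_of_set (e - {i})"
      using orderings[OF e] by simp
  qed
  also have "\<dots> = (\<Sum>e\<in>?E. \<Prod>j\<in>e - {i}. y $ j)"
  proof (intro sum.cong refl)
    fix e assume e: "e \<in> ?E"
    have "(\<Sum>js\<in>permutations_of_set (e - {i}). (\<Prod>j\<leftarrow>js. y $ j) / fact (r - 1))
        = (\<Sum>js\<in>permutations_of_set (e - {i}). (\<Prod>j\<in>e - {i}. y $ j) / fact (r - 1))"
      by (intro sum.cong refl)
        (metis permutations_of_setD(1) permutations_of_setD(2) prod.distinct_set_conv_list)
    also have "\<dots> = (\<Prod>j\<in>e - {i}. y $ j)"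
      using e unif by (simp add: uniform_def)
    finally show "(\<Sum>js\<in>permutations_of_set (e - {i}). (\<Prod>j\<leftarrow>js. y $ j) / fact (r - 1))
        = (\<Prod>j\<in>e - {i}. y $ j)" .
  qed
  finally show ?thesis .
qed

lemma real_eigen_equation:
  fixes H :: "'n::finite hypergraph" and x :: "real ^ 'n"
  assumes "r \<ge> 1" "uniform r H"
    and "eigenpair r (adjacency_tensor r H) (complex_of_real l) (\<chi> i. complex_of_real (x $ i))"
  shows "l * (x $ v) ^ (r - 1) = (\<Sum>e\<in>{e \<in> H. v \<in> e}. \<Prod>j\<in>e - {v}. x $ j)"
proof -
  have "complex_of_real (\<Sum>e\<in>{e \<in> H. v \<in> e}. \<Prod>j\<in>e - {v}. x $ j)
      = complex_of_real (l * (x $ v) ^ (r - 1))"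
    using assms by (simp add: eigenpair_def tensor_apply_adjacency_tensor)
  then show ?thesis
    by (simp only: of_real_eq_iff)
qed

lemma card_mult_prod_le_sum_power:
  fixes a :: "'a \<Rightarrow> real"
  assumes "finite S" "S \<noteq> {}" "\<And>i. i \<in> S \<Longrightarrow> a i \<ge> 0"
  shows "real (card S) * (\<Prod>i\<in>S. a i) \<le> (\<Sum>i\<in>S. a i ^ card S)"
proof -
  have pos: "card S > 0" using assms by (simp add: card_gt_0_iff)
  have "(\<Prod>i\<in>S. a i) = ((\<Prod>i\<in>S. a i) ^ card S) powr (1 / card S)"
    using pos assms(3) powr_realpow'[of "\<Prod>i\<in>S. a i" "card S", symmetric]
    by (simp add: powr_powr prod_nonneg)
  also have "\<dots> = (\<Prod>i\<in>S. a i ^ card S) powr (1 / card S)"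
    by (simp add: prod_power_distrib)
  also have "\<dots> \<le> (\<Sum>i\<in>S. a i ^ card S / card S)"
    using assms by (intro arith_geom_mean) auto
  finally show ?thesis
    using pos by (simp add: field_simps flip: sum_divide_distrib)
qed

lemma star_disjoint:
  assumes "linear_hypergraph H" "e \<in> H" "f \<in> H" "v \<in> e" "v \<in> f" "e \<noteq> f"
  shows "(e - {v}) \<inter> (f - {v}) = {}"
proof (rule ccontr)
  assume "(e - {v}) \<inter> (f - {v}) \<noteq> {}"
  then obtain u where "u \<noteq> v" "{u, v} \<subseteq> e \<inter> f"
    using assms by blast
  then have "2 \<le> card (e \<inter> f)"
    by (metis card_2_iff card_mono finite)
  moreover have "card (e \<inter> f) \<le> 1"
    using assms unfolding linear_hypergraph_def by blast
  ultimately show False by linarith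
qed

text \<open>
  Scaling the entry at \<open>v\<close> by a free factor \<open>s\<close> before applying the mean inequality to an edge
  makes a single inequality do the work of two: choosing \<open>s\<close> later replaces a separate
  power-mean estimate over the edges.
\<close>

lemma star_bound:
  fixes H :: "'n::finite hypergraph" and x :: "real ^ 'n"
  assumes r: "r \<ge> 1" and unif: "uniform r H" and lin: "linear_hypergraph H"
    and nonneg: "\<And>i. x $ i \<ge> 0" and s: "s \<ge> 0"
    and eigen: "l * (x $ v) ^ (r - 1) = (\<Sum>e\<in>{e \<in> H. v \<in> e}. \<Prod>j\<in>e - {v}. x $ j)"
  shows "(x $ v) ^ r * (1 + real r * s * l - real (vertex_degree H v) * s ^ r)
    \<le> (\<Sum>i\<in>UNIV. (x $ i) ^ r)"
proof -
  let ?E = "{e \<in> H. v \<in> e}"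
  let ?d = "real (vertex_degree H v)"
  have edge: "real r * (s * x $ v * (\<Prod>j\<in>e - {v}. x $ j))
      \<le> (s * x $ v) ^ r + (\<Sum>j\<in>e - {v}. (x $ j) ^ r)" if e: "e \<in> ?E" for e
  proof -
    let ?a = "\<lambda>j. if j = v then s * x $ v else x $ j"
    have card: "card e = r" using e unif by (simp add: uniform_def)
    have "real (card e) * (\<Prod>j\<in>e. ?a j) \<le> (\<Sum>j\<in>e. ?a j ^ card e)"
      using e nonneg s by (intro card_mult_prod_le_sum_power) auto
    moreover have "(\<Prod>j\<in>e. ?a j) = s * x $ v * (\<Prod>j\<in>e - {v}. x $ j)"
      using e by (subst prod.remove[of _ v]) (auto intro!: prod.cong)
    moreover have "(\<Sum>j\<in>e. ?a j ^ r) = (s * x $ v) ^ r + (\<Sum>j\<in>e - {v}. (x $ j) ^ r)"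
      using e by (subst sum.remove[of _ v]) (auto intro!: sum.cong)
    ultimately show ?thesis using card by simp
  qed
  have "real r * s * l * (x $ v) ^ r = real r * (s * x $ v * (l * (x $ v) ^ (r - 1)))"
    using r by (simp add: power_eq_if)
  also have "\<dots> = (\<Sum>e\<in>?E. real r * (s * x $ v * (\<Prod>j\<in>e - {v}. x $ j)))"
    by (simp only: eigen sum_distrib_left)
  also have "\<dots> \<le> (\<Sum>e\<in>?E. (s * x $ v) ^ r + (\<Sum>j\<in>e - {v}. (x $ j) ^ r))"
    by (intro sum_mono edge)
  also have "\<dots> = ?d * (s * x $ v) ^ r + (\<Sum>e\<in>?E. \<Sum>j\<in>e - {v}. (x $ j) ^ r)"
    by (simp add: sum.distrib vertex_degree_def)
  also have "(\<Sum>e\<in>?E. \<Sum>j\<in>e - {v}. (x $ j) ^ r) = (\<Sum>j\<in>(\<Union>e\<in>?E. e - {v}). (x $ j) ^ r)"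
    using star_disjoint[OF lin] by (intro sum.UNION_disjoint[symmetric]) auto
  also have "\<dots> \<le> (\<Sum>j\<in>UNIV - {v}. (x $ j) ^ r)"
    using nonneg by (intro sum_mono2) auto
  also have "\<dots> = (\<Sum>i\<in>UNIV. (x $ i) ^ r) - (x $ v) ^ r"
    by (simp add: sum_diff1)
  finally show ?thesis
    by (simp add: algebra_simps power_mult_distrib)
qed

theorem theorem3p1:
  fixes r d :: nat and H :: "'n::finite hypergraph" and \<rho> :: real
    and x :: "real ^ 'n" and v :: 'n
  assumes "r \<ge> 2"
    and "uniform r H" and "linear_hypergraph H" and "connected_hypergraph H"
    and "H \<noteq> {}"
    and "\<rho> = spectral_radius r H"
    and "principal_eigenvector r H x"
    and "d = vertex_degree H v"
  shows "x $ v \<le>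
    1 / (1 + (real r - 1) * (\<rho> ^ r / real d) powr (1 / (real r - 1))) powr (1 / real r)"
proof -
  define K where "K = 1 + (real r - 1) * (\<rho> ^ r / real d) powr (1 / (real r - 1))"
  have K: "K \<ge> 1" using assms(1) by (simp add: K_def)
  have pos: "x $ i > 0" for i
    using assms(7) by (simp add: principal_eigenvector_def)
  have eigen: "\<rho> * (x $ v) ^ (r - 1) = (\<Sum>e\<in>{e \<in> H. v \<in> e}. \<Prod>j\<in>e - {v}. x $ j)"
    using assms by (intro real_eigen_equation) (auto simp: principal_eigenvector_def)
  have "(\<Sum>i\<in>UNIV. (x $ i) ^ r) > 0"
    using pos by (intro sum_pos) auto
  moreover have "((\<Sum>i\<in>UNIV. (x $ i) ^ r) powr (1 / real r)) powr real r = 1"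
    using assms(7) by (simp add: principal_eigenvector_def)
  ultimately have norm: "(\<Sum>i\<in>UNIV. (x $ i) ^ r) = 1"
    using assms(1) by (simp add: powr_powr)
  have bound: "(x $ v) ^ r * (1 + real r * s * \<rho> - real d * s ^ r) \<le> 1" if "s \<ge> 0" for s
    using star_bound[OF _ assms(2,3) less_imp_le[OF pos] that eigen] assms(1,8) norm by simp
  have "(x $ v) ^ r * K \<le> 1"
  proof (cases "d = 0")
    case True
    \<comment> \<open>Division by zero makes \<open>K = 1\<close> here, and the claim reduces to \<open>x\<^sub>v\<^bsup>r\<^esup> \<le> 1\<close>.\<close>
    then show ?thesis using bound[of 0] by (simp add: K_def)
  next
    case False
    then have d: "d > 0" and star: "{e \<in> H. v \<in> e} \<noteq> {}"
      using assms(8) by (auto simp: vertex_degree_def card_gt_0_iff)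
    have "\<rho> * (x $ v) ^ (r - 1) > 0"
      unfolding eigen using star pos by (intro sum_pos prod_pos) auto
    then have \<rho>: "\<rho> > 0"
      using pos[of v] by (simp add: zero_less_mult_iff)
    define s where "s = (\<rho> / real d) powr (1 / (real r - 1))"
    have s: "s > 0" using \<rho> d by (simp add: s_def)
    have s_power: "s ^ (r - 1) = \<rho> / real d"
      using powr_realpow[OF s, of "r - 1"] assms(1) \<rho> d
      by (simp add: s_def powr_powr of_nat_diff)
    have split: "a ^ r = a * a ^ (r - 1)" for a :: real
      using assms(1) by (simp add: power_eq_if)
    have "\<rho> ^ r / real d = (\<rho> * s) ^ (r - 1)"
      using split[of \<rho>] s_power by (simp add: power_mult_distrib)
    also have "\<dots> = (\<rho> * s) powr (real r - 1)"
      using powr_realpow[of "\<rho> * s" "r - 1"] assms(1) \<rho> s by (simp add: of_nat_diff)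
    finally have "(\<rho> ^ r / real d) powr (1 / (real r - 1)) = \<rho> * s"
      using assms(1) \<rho> s by (simp add: powr_powr)
    moreover have "real d * s ^ r = s * \<rho>"
      using split[of s] s_power d by simp
    ultimately have "1 + real r * s * \<rho> - real d * s ^ r = K"
      by (simp add: K_def algebra_simps)
    then show ?thesis using bound[of s] s by simp
  qed
  then have "(x $ v) ^ r \<le> 1 / K"
    using K by (simp add: field_simps)
  then have "((x $ v) ^ r) powr (1 / real r) \<le> (1 / K) powr (1 / real r)"
    using pos[of v] by (intro powr_mono2) auto
  moreover have "((x $ v) ^ r) powr (1 / real r) = x $ v"
    using powr_realpow[OF pos[of v], of r, symmetric] pos[of v] assms(1) by (simp add: powr_powr)
  ultimately show ?thesis
    unfolding K_def[symmetric] using K by (simp add: powr_divide)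
qed

end
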